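(* Let $n\ge 3$ and let $L_n$ be the $n$-dimensional real filiform Lie algebra with basis $X_1,\dots,X_n$ and brackets $[X_1,X_i]=X_{i+1}$ for $2\le i\le n-1$ (all other brackets $[X_i,X_j]$ with $i<j$ being zero). Then there exist affine connections on $L_n$ which are not complete.
   Context: An affine connection on a real finite-dimensional Lie algebra $\mathfrak{g}$ is a bilinear map $\nabla:\mathfrak{g}\times\mathfrak{g}\to\mathfrak{g}$ such that for all $X,Y,Z\in\mathfrak{g}$: 1) $\nabla(X,Y)-\nabla(Y,X)=[X,Y]$; 2) $\nabla(X,\nabla(Y,Z))-\nabla(Y,\nabla(X,Z))=\nabla([X,Y],Z)$. Write $\nabla_X(Y)=\nabla(X,Y)$. Such a $\nabla$ corresponds to a left-invariant affine (flat and torsion-free) connection on a connected Lie group $G$ with Lie algebra $\mathfrak{g}$, and $\nabla$ is called complete if this connection is (geodesically) complete. Completeness is characterized algebraically as follows, a known fact which may be taken as the definition: $\nabla$ is complete if and only if, for every $X\in\mathfrak{g}$, the endomorphism $R_X\in\mathrm{End}(\mathfrak{g})$ defined by $R_X(Y)=\nabla_Y(X)$ is nilpotent. *)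

theory Defs
  imports "HOL-Analysis.Analysis"
begin

definition lie_bracket :: "('a::real_vector \<Rightarrow> 'a \<Rightarrow> 'a) \<Rightarrow> bool" where
  "lie_bracket br \<longleftrightarrow>
     bilinear br \<and>
     (\<forall>x. br x x = 0) \<and>
     (\<forall>x y z. br x (br y z) + br y (br z x) + br z (br x y) = 0)"

(* Curvature-free and torsion-free, i.e. a left-symmetric product whose commutator is br. *)
definition affine_connection ::
  "('a::real_vector \<Rightarrow> 'a \<Rightarrow> 'a) \<Rightarrow> ('a \<Rightarrow> 'a \<Rightarrow> 'a) \<Rightarrow> bool" where
  "affine_connection br nabla \<longleftrightarrow>
     bilinear nabla \<and>
     (\<forall>X Y. nabla X Y - nabla Y X = br X Y) \<and>
     (\<forall>X Y Z. nabla X (nabla Y Z) - nabla Y (nabla X Z) = nabla (br X Y) Z)"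

definition nilpotent_map :: "('a::real_vector \<Rightarrow> 'a) \<Rightarrow> bool" where
  "nilpotent_map f \<longleftrightarrow> (\<exists>k. f ^^ k = (\<lambda>_. 0))"

(* Geodesic completeness of the induced left-invariant connection, in its algebraic form:
   every right multiplication R_X = (Y \<mapsto> nabla Y X) is nilpotent. *)
definition complete_connection :: "('a::real_vector \<Rightarrow> 'a \<Rightarrow> 'a) \<Rightarrow> bool" where
  "complete_connection nabla \<longleftrightarrow> (\<forall>X. nilpotent_map (\<lambda>Y. nabla Y X))"

(* Only X 1, ..., X n matter; injectivity is what makes the dimension equal to n. *)
definition indexed_basis :: "nat \<Rightarrow> (nat \<Rightarrow> 'a::real_vector) \<Rightarrow> bool" where
  "indexed_basis n X \<longleftrightarrow>
     inj_on X {1..n} \<and> independent (X ` {1..n}) \<and> span (X ` {1..n}) = UNIV"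

(* The whole type 'a, with bracket br and basis X 1, ..., X n, is the Lie algebra L_n. *)
definition filiform_L ::
  "nat \<Rightarrow> ('a::real_vector \<Rightarrow> 'a \<Rightarrow> 'a) \<Rightarrow> (nat \<Rightarrow> 'a) \<Rightarrow> bool" where
  "filiform_L n br X \<longleftrightarrow>
     lie_bracket br \<and>
     indexed_basis n X \<and>
     (\<forall>i\<in>{2..n-1}. br (X 1) (X i) = X (Suc i)) \<and>
     (\<forall>i\<in>{1..n}. \<forall>j\<in>{1..n}. i < j \<and> \<not> (i = 1 \<and> j \<le> n - 1) \<longrightarrow> br (X i) (X j) = 0)"

(* L_n exists on every Euclidean space of dimension n. *)
lemma filiform_L_exists:
  assumes n: "n = DIM('a::euclidean_space)"
  shows "\<exists>(br :: 'a \<Rightarrow> 'a \<Rightarrow> 'a) X. filiform_L n br X"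
proof -
  obtain X where X: "bij_betw X {1..n} (Basis :: 'a set)"
    using ex_bij_betw_nat_finite_1[OF finite_Basis] n by blast
  then have im: "X ` {1..n} = Basis" and inj: "inj_on X {1..n}"
    by (auto simp: bij_betw_def)
  have inner: "X i \<bullet> X j = (if i = j then 1 else 0)" if "i \<in> {1..n}" "j \<in> {1..n}" for i j
    using that im inj by (metis (no_types, lifting) image_eqI inj_onD inner_Basis)
  define D :: "'a \<Rightarrow> 'a" where "D u = (\<Sum>i\<in>{2..n-1}. (u \<bullet> X i) *\<^sub>R X (Suc i))" for u
  define br :: "'a \<Rightarrow> 'a \<Rightarrow> 'a" where
    "br u v = (u \<bullet> X 1) *\<^sub>R D v - (v \<bullet> X 1) *\<^sub>R D u" for u v
  have lin: "linear D"
    unfolding D_def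
    by (intro linearI)
      (simp_all add: inner_add_left scaleR_add_left sum.distrib scaleR_sum_right)
  have bil: "bilinear br"
    unfolding bilinear_def br_def
    by (auto intro!: linearI
        simp: inner_add_left linear_add[OF lin] linear_scale[OF lin] algebra_simps)
  have D1: "D u \<bullet> X 1 = 0" for u
    unfolding D_def inner_sum_left
    by (rule sum.neutral) (auto simp: inner)
  have DX: "D (X j) = (if j \<in> {2..n-1} then X (Suc j) else 0)" if "j \<in> {1..n}" for j
  proof -
    have "D (X j) = (\<Sum>i\<in>{2..n-1}. if i = j then X (Suc i) else 0)"
      unfolding D_def using that by (intro sum.cong refl) (auto simp: inner)
    then show ?thesis by (simp add: sum.delta')
  qed
  have jac: "br x (br y z) + br y (br z x) + br z (br x y) = 0" for x y z
    unfolding br_def inner_diff_left inner_scaleR_left D1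
    by (simp add: linear_diff[OF lin] linear_scale[OF lin] algebra_simps)
  have X1: "X i \<bullet> X 1 = (if i = 1 then 1 else 0)" if "i \<in> {1..n}" for i
    using inner[of i 1] that by auto
  have brX: "br (X i) (X j) =
      (if i = 1 then D (X j) else 0) - (if j = 1 then D (X i) else 0)"
    if "i \<in> {1..n}" "j \<in> {1..n}" for i j
    unfolding br_def X1[OF that(1)] X1[OF that(2)] by simp
  have self: "br x x = 0" for x
    by (simp add: br_def)
  have "br (X 1) (X i) = X (Suc i)" if "i \<in> {2..n-1}" for i
    using that brX[of 1 i] DX[of i] by auto
  moreover have "br (X i) (X j) = 0"
    if "i \<in> {1..n}" "j \<in> {1..n}" "i < j" "\<not> (i = 1 \<and> j \<le> n - 1)" for i j
    using that brX[of i j] DX[of j] by (cases "i = 1") auto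
  ultimately have "filiform_L n br X"
    unfolding filiform_L_def lie_bracket_def indexed_basis_def im
    using bil jac self inj independent_Basis span_Basis by blast
  then show ?thesis by blast
qed

end

theory Submission
  imports Defs
begin

text \<open>The connection comes from an affine action of \<open>L\<^sub>n\<close> with an open orbit: a unipotent affine
  action in dimension \<open>n - 1\<close> for which \<open>X\<^sub>2\<close> spans the stabilizer of the base point, plus a line
  on which \<open>X\<^sub>2\<close> acts by \<open>1\<close> and the other basis vectors by \<open>0\<close>. Read off at the base point,
  \<open>\<nabla>(X\<^sub>1, X\<^sub>k) = ((k-2)/(k-1)) X\<^sub>k\<^sub>+\<^sub>1\<close> and \<open>\<nabla>(X\<^sub>k, X\<^sub>1) = -(1/(k-1)) X\<^sub>k\<^sub>+\<^sub>1\<close> for \<open>2 \<le> k < n\<close>,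
  and \<open>\<nabla>(X\<^sub>2, X\<^sub>2) = X\<^sub>2\<close>, all other products of basis vectors being zero. It is incomplete because right
  multiplication by \<open>X\<^sub>2\<close> fixes \<open>X\<^sub>2\<close>.\<close>

lemma indexed_basis_linear_extension:
  fixes X :: "nat \<Rightarrow> 'a::real_vector" and f :: "nat \<Rightarrow> 'b::real_vector"
  assumes "indexed_basis n X"
  shows "\<exists>g. linear g \<and> (\<forall>i\<in>{1..n}. g (X i) = f i)"
proof -
  have inj: "inj_on X {1..n}" and ind: "independent (X ` {1..n})"
    using assms by (simp_all add: indexed_basis_def)
  obtain g where "linear g" "\<forall>x\<in>X ` {1..n}. g x = f (inv_into {1..n} X x)"
    using linear_independent_extend[OF ind, of "\<lambda>x. f (inv_into {1..n} X x)"] by blast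
  then have "linear g \<and> (\<forall>i\<in>{1..n}. g (X i) = f i)"
    using inj by simp
  then show ?thesis
    by (intro exI[of _ g])
qed

lemma linear_eq_on_indexed_basis:
  assumes "indexed_basis n X" "linear f" "linear g"
    and "\<And>i. i \<in> {1..n} \<Longrightarrow> f (X i) = g (X i)"
  shows "f x = g x"
proof (rule linear_eq_on_span[OF assms(2,3)])
  show "x \<in> span (X ` {1..n})"
    using assms(1) by (simp add: indexed_basis_def)
qed (use assms(4) in auto)

lemma bilinear_eq_on_indexed_basis:
  assumes "indexed_basis n X" "bilinear f" "bilinear g"
    and "\<And>i j. i \<in> {1..n} \<Longrightarrow> j \<in> {1..n} \<Longrightarrow> f (X i) (X j) = g (X i) (X j)"
  shows "f x y = g x y"
proof (rule bilinear_eq[OF assms(2,3)])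
  show "UNIV \<subseteq> span (X ` {1..n})" "UNIV \<subseteq> span (X ` {1..n})"
    using assms(1) by (simp_all add: indexed_basis_def)
qed (use assms(4) in auto)

lemma lie_bracket_skew:
  assumes "lie_bracket br"
  shows "br y x = - br x y"
proof -
  have bil: "bilinear br" and self: "br z z = 0" for z
    using assms by (auto simp: lie_bracket_def)
  have "br (x + y) (x + y) = br x x + br x y + (br y x + br y y)"
    by (simp add: bilinear_ladd[OF bil] bilinear_radd[OF bil])
  then show ?thesis
    by (simp add: self eq_neg_iff_add_eq_0 add.commute)
qed

text \<open>Covers two cases: the bracket, with \<open>P = S = D\<close> and \<open>e = 0\<close>,
  and the connection, with \<open>P = D - S\<close>.\<close>

lemma bilinear_linear_combination:
  fixes a b :: "'a::real_vector \<Rightarrow> real"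
  assumes "linear a" "linear b" "linear P" "linear S"
  shows "bilinear (\<lambda>u v. a u *\<^sub>R P v - a v *\<^sub>R S u + (b u * b v) *\<^sub>R e)"
  unfolding bilinear_def
  by (auto intro!: linearI simp: linear_add[OF assms(1)] linear_add[OF assms(2)]
      linear_add[OF assms(3)] linear_add[OF assms(4)] linear_scale[OF assms(1)]
      linear_scale[OF assms(2)] linear_scale[OF assms(3)] linear_scale[OF assms(4)]
      algebra_simps)

text \<open>In the torsion the \<open>S\<close> terms cancel and the \<open>e\<close> term is
  symmetric, which leaves the bracket. Since \<open>a\<close> and \<open>b\<close> kill the images
  of \<open>D\<close> and \<open>S\<close>, and \<open>D - S\<close> kills \<open>e\<close>, the
  \<open>e\<close> term does not interact with the rest in double products. Flatness then comes down
  to the commutator relation \<open>D S - S D = S S\<close>.\<close>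

lemma affine_connection_semidirect:
  fixes a b :: "'a::real_vector \<Rightarrow> real" and br :: "'a \<Rightarrow> 'a \<Rightarrow> 'a"
  assumes lin: "linear a" "linear b" "linear D" "linear S"
    and br: "\<And>u v. br u v = a u *\<^sub>R D v - a v *\<^sub>R D u"
    and a: "\<And>u. a (D u) = 0" "\<And>u. a (S u) = 0" "a e = 0"
    and b: "\<And>u. b (D u) = 0" "\<And>u. b (S u) = 0" "b e = 1"
    and e: "D e = S e"
    and DS: "\<And>u. D (S u) - S (S u) = S (D u)"
  shows "affine_connection br
    (\<lambda>u v. a u *\<^sub>R (D v - S v) - a v *\<^sub>R S u + (b u * b v) *\<^sub>R e)" (is "affine_connection br ?nabla")
proof -
  note add = lin[THEN linear_add] and diff = lin[THEN linear_diff]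
    and scale = lin[THEN linear_scale]
  have "bilinear ?nabla"
    by (intro bilinear_linear_combination lin linear_compose_sub)
  moreover have "?nabla u v - ?nabla v u = br u v" for u v
    by (simp add: br algebra_simps)
  moreover have "?nabla u (?nabla v w) - ?nabla v (?nabla u w) = ?nabla (br u v) w" for u v w
  proof -
    \<comment> \<open>The first and last summands are symmetric in \<open>u\<close> and
      \<open>v\<close>, so only the middle one survives in the curvature. It arises from
      \<open>(D - S) (S v)\<close>, which \<open>DS\<close> turns into
      \<open>S (D v)\<close>.\<close>
    have nabla2: "?nabla u (?nabla v w) =
        (a u * a v) *\<^sub>R (D (D w - S w) - S (D w - S w)) - (a w * a u) *\<^sub>R S (D v)
          + (b u * b v * b w) *\<^sub>R e" for u v
      by (simp add: add diff scale a b e flip: DS) (simp add: algebra_simps)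
    have "?nabla (br u v) w = - a w *\<^sub>R S (br u v)"
      by (simp add: br diff scale a b)
    also have "\<dots> = - (a w * a u) *\<^sub>R S (D v) + (a w * a v) *\<^sub>R S (D u)"
      by (simp add: br diff scale algebra_simps)
    finally show ?thesis
      unfolding nabla2 by (simp add: algebra_simps)
  qed
  ultimately show ?thesis
    unfolding affine_connection_def by blast
qed

lemma not_nilpotent_map_fixed_point:
  assumes "f x = x" "x \<noteq> 0"
  shows "\<not> nilpotent_map f"
proof
  assume "nilpotent_map f"
  then obtain k where "f ^^ k = (\<lambda>_. 0)"
    by (auto simp: nilpotent_map_def)
  moreover have "(f ^^ k) x = x"
    by (induction k) (auto simp: assms(1))
  ultimately show False
    using assms(2) by simp
qed

theorem proposition2:
  fixes n :: nat
    and br :: "'a::real_vector \<Rightarrow> 'a \<Rightarrow> 'a"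
    and X :: "nat \<Rightarrow> 'a"
  assumes "n \<ge> 3"
    and "filiform_L n br X"
  shows "\<exists>nabla. affine_connection br nabla \<and> \<not> complete_connection nabla"
proof -
  have lie: "lie_bracket br" and basis: "indexed_basis n X"
    using assms(2) by (auto simp: filiform_L_def)
  have br1: "br (X 1) (X i) = X (Suc i)" if "i \<in> {2..n-1}" for i
    using assms(2) that by (auto simp: filiform_L_def)
  have br0: "br (X i) (X j) = 0"
    if "i \<in> {1..n}" "j \<in> {1..n}" "i < j" "\<not> (i = 1 \<and> j \<le> n - 1)" for i j
    using assms(2) that by (simp add: filiform_L_def)
  have bil: "bilinear br" and self: "br x x = 0" for x
    using lie by (auto simp: lie_bracket_def)
  obtain a :: "'a \<Rightarrow> real"
    where a: "linear a" "\<And>i. i \<in> {1..n} \<Longrightarrow> a (X i) = (if i = 1 then 1 else 0)"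
    using indexed_basis_linear_extension[OF basis, of "\<lambda>i. (if i = 1 then 1 else 0)"]
    by blast
  obtain b :: "'a \<Rightarrow> real"
    where b: "linear b" "\<And>i. i \<in> {1..n} \<Longrightarrow> b (X i) = (if i = 2 then 1 else 0)"
    using indexed_basis_linear_extension[OF basis, of "\<lambda>i. (if i = 2 then 1 else 0)"]
    by blast
  \<comment> \<open>With \<open>S (X i) = s i *\<^sub>R X (Suc i)\<close>, the relation
    \<open>DS\<close> demands \<open>1 / s (i+1) = 1 / s i + 1\<close>, and
    \<open>D (X 2) = S (X 2)\<close> demands \<open>s 2 = 1\<close>; hence
    \<open>s i = 1 / (i - 1)\<close>.\<close>
  obtain S where S: "linear S" "\<And>i. i \<in> {1..n} \<Longrightarrow>
      S (X i) = (if i \<in> {2..n-1} then (1 / (real i - 1)) *\<^sub>R X (Suc i) else 0)"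
    using indexed_basis_linear_extension[OF basis, of "\<lambda>i. (if i \<in> {2..n-1} then (1 / (real i - 1)) *\<^sub>R X (Suc i) else 0)"]
    by blast
  define D where "D = br (X 1)"
  have linD: "linear D"
    using bil by (simp add: D_def bilinear_def)
  have D: "D (X i) = (if i \<in> {2..n-1} then X (Suc i) else 0)" if "i \<in> {1..n}" for i
    using that assms(1) br1[of i] br0[of 1 i] self by (cases "i = 1") (auto simp: D_def)
  \<comment> \<open>Brackets are prescribed only for \<open>i < j\<close>; skew symmetry gives the
    others, and bilinearity extends the formula to all vectors.\<close>
  have "br (X i) (X j) = a (X i) *\<^sub>R D (X j) - a (X j) *\<^sub>R D (X i)"
    if ij: "i \<in> {1..n}" "j \<in> {1..n}" for i j
  proof -
    consider "i = 1" | "j = 1" | "i \<noteq> 1" "j \<noteq> 1" by blast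
    then show ?thesis
    proof cases
      case 3
      then have "br (X i) (X j) = 0"
        using ij br0[of i j] br0[of j i] self lie_bracket_skew[OF lie, of "X j" "X i"]
        by (cases i j rule: linorder_cases) auto
      then show ?thesis using 3 ij by (simp add: a)
    qed (use ij lie_bracket_skew[OF lie, of "X 1" "X i"] self in \<open>auto simp: a D_def\<close>)
  qed
  moreover have "bilinear (\<lambda>u v. a u *\<^sub>R D v - a v *\<^sub>R D u)"
    using bilinear_linear_combination[OF a(1) a(1) linD linD, of 0] by simp
  ultimately have br: "br u v = a u *\<^sub>R D v - a v *\<^sub>R D u" for u v
    using bilinear_eq_on_indexed_basis[OF basis bil] by blast
  note lin = a(1) b(1) linD S(1)
  note zero = linear_0[OF S(1)] linear_0[OF linD] linear_0[OF a(1)] linear_0[OF b(1)]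
  note scale = lin[THEN linear_scale]
  \<comment> \<open>The images of \<open>D\<close> and \<open>S\<close> lie in the span of
    \<open>X 3, ..., X n\<close>, where both coordinates \<open>a\<close> and \<open>b\<close> are
    zero.\<close>
  have vanish: "a (D u) = 0" "a (S u) = 0" "b (D u) = 0" "b (S u) = 0" for u
    by (rule linear_eq_on_indexed_basis[OF basis, where g = "\<lambda>_. 0"];
        use linear_compose[OF linD a(1)] linear_compose[OF S(1) a(1)]
          linear_compose[OF linD b(1)] linear_compose[OF S(1) b(1)]
        in \<open>auto simp: o_def D S(2) a(2) b(2) scale zero linear_zero\<close>)+
  have DS: "D (S u) - S (S u) = S (D u)" for u
  proof (rule linear_eq_on_indexed_basis[OF basis,
        where f = "\<lambda>u. D (S u) - S (S u)" and g = "\<lambda>u. S (D u)"])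
    show "linear (\<lambda>u. D (S u) - S (S u))" "linear (\<lambda>u. S (D u))"
      using linear_compose[OF S(1) linD] linear_compose[OF S(1) S(1)] linear_compose[OF linD S(1)]
      by (auto simp: o_def intro!: linear_compose_sub)
    \<comment> \<open>This compares the coefficients of \<open>X (i+2)\<close> for
      \<open>2 \<le> i \<le> n-2\<close>; on the remaining basis vectors both sides of
      \<open>DS\<close> vanish.\<close>
    have coeff: "1 / (real i - 1) - 1 / ((real i - 1) * real i) = 1 / real i" if "i \<ge> 2" for i
    proof -
      have "real i \<noteq> 0" "real i - 1 \<noteq> 0"
        using that by auto
      then show ?thesis
        by (simp add: divide_simps)
    qed
    show "D (S (X i)) - S (S (X i)) = S (D (X i))" if "i \<in> {1..n}" for i
      using that coeff[of i]
      by (auto simp: D S(2) scale zero simp flip: scaleR_diff_left)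
  qed
  define nabla where "nabla u v = a u *\<^sub>R (D v - S v) - a v *\<^sub>R S u + (b u * b v) *\<^sub>R X 2" for u v
  have X2: "a (X 2) = 0" "b (X 2) = 1" "D (X 2) = S (X 2)"
    using assms(1) by (simp_all add: a b D S(2))
  have "affine_connection br nabla"
    unfolding nabla_def
    by (rule affine_connection_semidirect) (use lin br vanish X2 DS in auto)
  moreover have "nabla (X 2) (X 2) = X 2"
    by (simp add: nabla_def X2)
  moreover have "X 2 \<noteq> 0"
    using X2(2) zero by auto
  ultimately show ?thesis
    using not_nilpotent_map_fixed_point[of "\<lambda>Y. nabla Y (X 2)" "X 2"]
    unfolding complete_connection_def by blast
qed

end
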